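(* Let $n\ge3$, $1<d_1<d_2<\infty$ and $1\le r\le\infty$. Then there exists a constant $C>0$ such that $$\big\|[E(t)f]|_0\big\|_{L^{(d_2,r)}(\partial\mathbb{R}^n_+)}\le C\,t^{-\left(\frac{n}{2d_1}-\frac{n-1}{2d_2}\right)}\|f\|_{L^{(d_1,r)}(\mathbb{R}^n_+)}$$ for all $f\in L^{(d_1,r)}(\mathbb{R}^n_+)$ and all $t>0$.
   Context: $\mathbb{R}^n_+=\{x=(x',x_n): x'\in\mathbb{R}^{n-1},\ x_n>0\}$; $\partial\mathbb{R}^n_+$ is identified with $\mathbb{R}^{n-1}$ with Lebesgue measure $dx'$. $E(t)f(x)=\int_{\mathbb{R}^n_+}G(x,y,t)f(y)\,dy$ for $x\in\overline{\mathbb{R}^n_+}$, $t>0$, where, with $y^*=(y',-y_n)$, $G(x,y,t)=(4\pi t)^{-n/2}\left[e^{-|x-y|^2/(4t)}+e^{-|x-y^*|^2/(4t)}\right]$. For a function $f$ on $\overline{\mathbb{R}^n_+}$, $f|_0=f(\cdot,0)$ is its restriction to $\partial\mathbb{R}^n_+$. Lorentz spaces: for measurable $f$ on $\Omega$, $f^*(t)=\inf\{s>0:|\{x\in\Omega:|f(x)|>s\}|\le t\}$, $f^{**}(t)=\frac1t\int_0^tf^*(s)\,ds$; for $1<d<\infty$, $L^{(d,r)}(\Omega)$ is normed by $\|f\|_{L^{(d,r)}(\Omega)}=\left[\int_0^\infty(t^{1/d}f^{**}(t))^r\frac{dt}{t}\right]^{1/r}$ if $1\le r<\infty$ and $\sup_{t>0}t^{1/d}f^{**}(t)$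 if $r=\infty$. *)

theory Defs
  imports "HOL-Analysis.Analysis"
begin

text \<open>
  Points of \<open>n\<close>-dimensional space are written as pairs \<open>(x', x\<^sub>n)\<close>
  of type \<^typ>\<open>(real ^ 'm) \<times> real\<close>, so that \<open>n = CARD('m) + 1\<close>. The norm
  of the product type is the Euclidean one. The boundary of the half space is identified with
  \<^typ>\<open>real ^ 'm\<close>.
\<close>

definition half_space :: "((real ^ 'm::finite) \<times> real) set" where
  "half_space = {x. snd x > 0}"

definition reflect :: "(real ^ 'm::finite) \<times> real \<Rightarrow> (real ^ 'm) \<times> real" where
  "reflect y = (fst y, - snd y)"

definition neumann_kernel ::
  "(real ^ 'm::finite) \<times> real \<Rightarrow> (real ^ 'm) \<times> real \<Rightarrow> real \<Rightarrow> real" where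
  "neumann_kernel x y t =
     (4 * pi * t) powr (- (real DIM((real ^ 'm) \<times> real) / 2)) *
     (exp (- ((norm (x - y))\<^sup>2 / (4 * t))) + exp (- ((norm (x - reflect y))\<^sup>2 / (4 * t))))"

definition heat_op ::
  "real \<Rightarrow> ((real ^ 'm::finite) \<times> real \<Rightarrow> real) \<Rightarrow> (real ^ 'm) \<times> real \<Rightarrow> real" where
  "heat_op t f x = (\<integral>y. neumann_kernel x y t * f y \<partial>(lebesgue_on half_space))"

definition boundary_trace ::
  "((real ^ 'm::finite) \<times> real \<Rightarrow> real) \<Rightarrow> real ^ 'm \<Rightarrow> real" where
  "boundary_trace g x' = g (x', 0)"

text \<open>
  The rearrangements and Lorentz norms take values in \<^typ>\<open>ennreal\<close>: the infimum of
  the empty set is \<open>\<infinity>\<close>, and all integrals of nonnegative functions are meaningful.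
\<close>

definition decr_rearr :: "'a measure \<Rightarrow> ('a \<Rightarrow> real) \<Rightarrow> real \<Rightarrow> ennreal" where
  "decr_rearr M f t =
     Inf {ennreal s | s. s > 0 \<and> emeasure M {x \<in> space M. \<bar>f x\<bar> > s} \<le> ennreal t}"

definition avg_rearr :: "'a measure \<Rightarrow> ('a \<Rightarrow> real) \<Rightarrow> real \<Rightarrow> ennreal" where
  "avg_rearr M f t = ennreal (1 / t) * (\<integral>\<^sup>+ s \<in> {0<..<t}. decr_rearr M f s \<partial>lborel)"

text \<open>Real powers on \<^typ>\<open>ennreal\<close>; only used with positive exponents.\<close>

definition ennreal_powr :: "ennreal \<Rightarrow> real \<Rightarrow> ennreal" where
  "ennreal_powr x p = (if x = \<infinity> then \<infinity> else ennreal (enn2real x powr p))"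

definition lorentz_norm :: "real \<Rightarrow> ennreal \<Rightarrow> 'a measure \<Rightarrow> ('a \<Rightarrow> real) \<Rightarrow> ennreal" where
  "lorentz_norm d r M f =
     (if r = \<infinity> then (SUP t \<in> {0<..}. ennreal (t powr (1 / d)) * avg_rearr M f t)
      else ennreal_powr
        (\<integral>\<^sup>+ t \<in> {0<..}.
            ennreal_powr (ennreal (t powr (1 / d)) * avg_rearr M f t) (enn2real r) * ennreal (1 / t)
          \<partial>lborel)
        (1 / enn2real r))"

definition lorentz_space :: "real \<Rightarrow> ennreal \<Rightarrow> 'a measure \<Rightarrow> ('a \<Rightarrow> real) set" where
  "lorentz_space d r M = {f \<in> borel_measurable M. lorentz_norm d r M f < \<infinity>}"

end

theory Submission
  imports Defs "HOL-Probability.Distributions"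
begin

text \<open>
  The kernel \<open>K(x', y) = G((x', 0), y, t)\<close> satisfies \<open>K \<le> A = 2(4\<pi>t)\<^sup>-\<^sup>n\<^sup>/\<^sup>2\<close>,
  \<open>\<integral>K dy \<le> 2\<close> and \<open>\<integral>K dx' \<le> B = 2(4\<pi>t)\<^sup>-\<^sup>1\<^sup>/\<^sup>2\<close>. Splitting \<open>f\<close> at
  the level \<open>f\<^sup>*(u)\<close> into a bounded part and an integrable excess, with \<open>u = 2/A\<close> and
  \<open>u = 2s/B\<close> respectively, gives for the trace \<open>g\<close> the bounds \<open>|g| \<le> 2 f\<^sup>*\<^sup>*(a)\<close> and
  \<open>g\<^sup>*\<^sup>*(s) \<le> 2 f\<^sup>*\<^sup>*(b s)\<close>, where \<open>a = 2/A\<close> and \<open>b = 2/B\<close>. Hence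
  \<open>g\<^sup>*\<^sup>*(s) \<le> 2 f\<^sup>*\<^sup>*(max a (b s))\<close>. In the Lorentz norm of \<open>g\<close> the range \<open>s \<le> a/b\<close> is
  controlled by \<open>f\<^sup>*\<^sup>*(a)\<close> alone, and on the range \<open>s > a/b\<close> the substitution \<open>u = b s\<close> and the
  inequality \<open>u powr (1/d\<^sub>2 - 1/d\<^sub>1) \<le> a powr (1/d\<^sub>2 - 1/d\<^sub>1)\<close> lead back to the norm of \<open>f\<close>.
\<close>

section \<open>Decreasing rearrangement and the layer cake formula\<close>

text \<open>Superlevel sets of an antitone function on the line are down-closed, hence intervals.
  This serves both \<open>decr_rearr\<close> and distribution functions.\<close>

lemma borel_measurable_antimono_ennreal:
  fixes F :: "real \<Rightarrow> ennreal"
  assumes "antimono F"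
  shows "F \<in> borel_measurable borel"
proof (rule borel_measurableI_greater)
  fix y :: ennreal
  have "is_interval {x. y < F x}"
    using assms by (auto simp: is_interval_1 antimono_def intro: less_le_trans)
  then have "{x. y < F x} \<in> sets borel"
    by (rule is_real_interval[THEN exE]) (elim exE disjE; simp only:; measurable)
  then show "{x \<in> space borel. y < F x} \<in> sets borel" by simp
qed

lemma decr_rearr_le:
  assumes "0 < s" "emeasure M {x \<in> space M. s < \<bar>f x\<bar>} \<le> ennreal t"
  shows "decr_rearr M f t \<le> ennreal s"
  unfolding decr_rearr_def using assms by (auto intro: Inf_lower)

lemma decr_rearr_ge:
  assumes "\<And>s. 0 < s \<Longrightarrow> emeasure M {x \<in> space M. s < \<bar>f x\<bar>} \<le> ennreal t \<Longrightarrow> z \<le> ennreal s"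
  shows "z \<le> decr_rearr M f t"
  unfolding decr_rearr_def using assms by (auto intro: Inf_greatest)

lemma antimono_decr_rearr: "antimono (decr_rearr M f)"
  by (intro antimonoI decr_rearr_ge decr_rearr_le) (auto intro: order_trans ennreal_leI)

lemma borel_measurable_decr_rearr [measurable]: "decr_rearr M f \<in> borel_measurable borel"
  by (intro borel_measurable_antimono_ennreal antimono_decr_rearr)

text \<open>Rewrites a possibly infinite value as the length of an interval, so that Fubini's
  theorem can be applied to regions under a graph.\<close>

lemma emeasure_lborel_below_ennreal:
  "emeasure lborel {v::real. 0 < v \<and> ennreal v < z} = z"
  "emeasure lborel {v::real. 0 < v \<and> ennreal v \<le> z} = z"
proof -
  have *: "ennreal r \<le> emeasure lborel {0::real<..}" if "0 \<le> r" for r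
    using emeasure_mono[of "{0<..<r}" "{0::real<..}" lborel] that
    by (simp add: subset_eq)
  have inf: "emeasure lborel {0::real<..} = top"
  proof (cases "emeasure lborel {0::real<..}")
    case (real r)
    then show ?thesis using * [of "r + 1"] by (simp add: ennreal_le_iff del: ennreal_plus)
  qed
  show "emeasure lborel {v::real. 0 < v \<and> ennreal v < z} = z"
  proof (cases z)
    case (real r)
    then have "{v::real. 0 < v \<and> ennreal v < z} = {0<..<r}"
      by (auto simp: set_eq_iff ennreal_less_iff)
    with real show ?thesis by simp
  next
    case top
    then have "{v::real. 0 < v \<and> ennreal v < z} = {0<..}" by (simp add: set_eq_iff)
    with top inf show ?thesis by simp
  qed
  show "emeasure lborel {v::real. 0 < v \<and> ennreal v \<le> z} = z"
  proof (cases z)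
    case (real r)
    then have "{v::real. 0 < v \<and> ennreal v \<le> z} = {0<..r}"
      by (simp add: set_eq_iff)
    with real show ?thesis by simp
  next
    case top
    then have "{v::real. 0 < v \<and> ennreal v \<le> z} = {0<..}" by (simp add: set_eq_iff)
    with top inf show ?thesis by simp
  qed
qed

text \<open>Both sides measure the planar region \<open>0 < v < m \<sigma>\<close> under the
  distribution function \<open>m\<close>: slices at fixed \<open>\<sigma>\<close> give the layer
  cake integral of \<open>\<bar>f\<bar>\<close>, slices at fixed \<open>v\<close> have length
  \<open>f\<^sup>*(v)\<close>.\<close>

lemma nn_integral_decr_rearr:
  assumes "sigma_finite_measure M" and [measurable]: "f \<in> borel_measurable M"
  shows "(\<integral>\<^sup>+ v \<in> {0<..}. decr_rearr M f v \<partial>lborel) = (\<integral>\<^sup>+ x. ennreal \<bar>f x\<bar> \<partial>M)"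
proof -
  interpret M: sigma_finite_measure M by fact
  interpret P: pair_sigma_finite M "lborel :: real measure" ..
  define m where "m \<sigma> = emeasure M {x \<in> space M. \<sigma> < \<bar>f x\<bar>}" for \<sigma> :: real
  have "antimono m"
    unfolding m_def by (intro antimonoI emeasure_mono) auto
  then have [measurable]: "m \<in> borel_measurable borel"
    by (rule borel_measurable_antimono_ennreal)
  have "(\<integral>\<^sup>+ x. ennreal \<bar>f x\<bar> \<partial>M) =
      (\<integral>\<^sup>+ x. (\<integral>\<^sup>+ \<sigma>. indicator {z. 0 < snd z \<and> snd z < \<bar>f (fst z)\<bar>} (x, \<sigma>) \<partial>lborel) \<partial>M)"
  proof (intro nn_integral_cong)
    fix x
    have "(\<integral>\<^sup>+ \<sigma>. indicator {z. 0 < snd z \<and> snd z < \<bar>f (fst z)\<bar>} (x, \<sigma>) \<partial>lborel) =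
        (\<integral>\<^sup>+ \<sigma>. indicator {0<..<\<bar>f x\<bar>} \<sigma> \<partial>lborel)"
      by (intro nn_integral_cong) (auto split: split_indicator)
    then show "ennreal \<bar>f x\<bar> =
        (\<integral>\<^sup>+ \<sigma>. indicator {z. 0 < snd z \<and> snd z < \<bar>f (fst z)\<bar>} (x, \<sigma>) \<partial>lborel)"
      by simp
  qed
  also have "\<dots> =
      (\<integral>\<^sup>+ \<sigma>. (\<integral>\<^sup>+ x. indicator {z. 0 < snd z \<and> snd z < \<bar>f (fst z)\<bar>} (x, \<sigma>) \<partial>M) \<partial>lborel)"
    by (intro P.Fubini'[symmetric]) measurable
  also have "\<dots> = (\<integral>\<^sup>+ \<sigma>. m \<sigma> * indicator {0<..} \<sigma> \<partial>lborel)"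
  proof (intro nn_integral_cong)
    fix \<sigma> :: real
    have "(\<integral>\<^sup>+ x. indicator {z. 0 < snd z \<and> snd z < \<bar>f (fst z)\<bar>} (x, \<sigma>) \<partial>M) =
        (\<integral>\<^sup>+ x. indicator {0<..} \<sigma> * indicator {x \<in> space M. \<sigma> < \<bar>f x\<bar>} x \<partial>M)"
      by (intro nn_integral_cong) (auto split: split_indicator)
    also have "\<dots> = m \<sigma> * indicator {0<..} \<sigma>"
      unfolding m_def by (subst nn_integral_cmult) (auto simp: mult.commute)
    finally show "(\<integral>\<^sup>+ x. indicator {z. 0 < snd z \<and> snd z < \<bar>f (fst z)\<bar>} (x, \<sigma>) \<partial>M) =
        m \<sigma> * indicator {0<..} \<sigma>" .
  qed
  also have "\<dots> = (\<integral>\<^sup>+ \<sigma>. (\<integral>\<^sup>+ v. indicator {z. 0 < fst z \<and> 0 < snd z \<and> ennreal (snd z) < m (fst z)} (\<sigma>, v) \<partial>lborel) \<partial>lborel)"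
  proof (intro nn_integral_cong)
    fix \<sigma> :: real
    have "(\<integral>\<^sup>+ v. indicator {z. 0 < fst z \<and> 0 < snd z \<and> ennreal (snd z) < m (fst z)} (\<sigma>, v) \<partial>lborel) =
        (\<integral>\<^sup>+ v. indicator {0<..} \<sigma> * indicator {v::real. 0 < v \<and> ennreal v < m \<sigma>} v \<partial>lborel)"
      by (intro nn_integral_cong) (auto split: split_indicator)
    also have "\<dots> = m \<sigma> * indicator {0<..} \<sigma>"
      by (subst nn_integral_cmult) (auto simp: mult.commute emeasure_lborel_below_ennreal)
    finally show "m \<sigma> * indicator {0<..} \<sigma> =
        (\<integral>\<^sup>+ v. indicator {z. 0 < fst z \<and> 0 < snd z \<and> ennreal (snd z) < m (fst z)} (\<sigma>, v) \<partial>lborel)" ..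
  qed
  also have "\<dots> = (\<integral>\<^sup>+ v. (\<integral>\<^sup>+ \<sigma>. indicator {z. 0 < fst z \<and> 0 < snd z \<and> ennreal (snd z) < m (fst z)} (\<sigma>, v) \<partial>lborel) \<partial>lborel)"
    by (intro lborel_pair.Fubini'[symmetric]) measurable
  also have "\<dots> = (\<integral>\<^sup>+ v. decr_rearr M f v * indicator {0<..} v \<partial>lborel)"
  proof (intro nn_integral_cong)
    fix v :: real
    have "(\<integral>\<^sup>+ \<sigma>. indicator {z. 0 < fst z \<and> 0 < snd z \<and> ennreal (snd z) < m (fst z)} (\<sigma>, v) \<partial>lborel) =
        (\<integral>\<^sup>+ \<sigma>. indicator {0<..} v * indicator {\<sigma>::real. 0 < \<sigma> \<and> ennreal v < m \<sigma>} \<sigma> \<partial>lborel)"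
      by (intro nn_integral_cong) (auto split: split_indicator)
    also have "\<dots> = indicator {0<..} v * emeasure lborel {\<sigma>::real. 0 < \<sigma> \<and> ennreal v < m \<sigma>}"
      by (subst nn_integral_cmult) auto
    \<comment> \<open>The slice is squeezed between the open and the half-closed interval from 0 to
      \<open>f\<^sup>*(v)\<close>; whether the endpoint belongs to it is irrelevant for its
      length.\<close>
    also have "emeasure lborel {\<sigma>::real. 0 < \<sigma> \<and> ennreal v < m \<sigma>} = decr_rearr M f v"
    proof (rule antisym)
      have "emeasure lborel {\<sigma>::real. 0 < \<sigma> \<and> ennreal v < m \<sigma>} \<le>
          emeasure lborel {\<sigma>::real. 0 < \<sigma> \<and> ennreal \<sigma> \<le> decr_rearr M f v}"
      proof (intro emeasure_mono subsetI CollectI conjI decr_rearr_ge)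
        fix \<sigma> s :: real
        assume "\<sigma> \<in> {\<sigma>. 0 < \<sigma> \<and> ennreal v < m \<sigma>}" "0 < s" 
          "emeasure M {x \<in> space M. s < \<bar>f x\<bar>} \<le> ennreal v"
        then have "m s < m \<sigma>" by (auto simp: m_def)
        then have "\<not> s \<le> \<sigma>" using antimonoD[OF \<open>antimono m\<close>, of s \<sigma>] by auto
        then show "ennreal \<sigma> \<le> ennreal s" by (intro ennreal_leI) auto
      qed auto
      then show "emeasure lborel {\<sigma>::real. 0 < \<sigma> \<and> ennreal v < m \<sigma>} \<le> decr_rearr M f v"
        by (simp add: emeasure_lborel_below_ennreal)
      have "emeasure lborel {\<sigma>::real. 0 < \<sigma> \<and> ennreal \<sigma> < decr_rearr M f v} \<le>
          emeasure lborel {\<sigma>::real. 0 < \<sigma> \<and> ennreal v < m \<sigma>}"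
        by (intro emeasure_mono) (auto simp: m_def not_le[symmetric] intro: decr_rearr_le)
      then show "decr_rearr M f v \<le> emeasure lborel {\<sigma>::real. 0 < \<sigma> \<and> ennreal v < m \<sigma>}"
        by (simp add: emeasure_lborel_below_ennreal)
    qed
    finally show "(\<integral>\<^sup>+ \<sigma>. indicator {z. 0 < fst z \<and> 0 < snd z \<and> ennreal (snd z) < m (fst z)} (\<sigma>, v) \<partial>lborel) =
        decr_rearr M f v * indicator {0<..} v" by (simp add: mult.commute)
  qed
  finally show ?thesis ..
qed

lemma decr_rearr_le_add:
  assumes [measurable]: "f \<in> borel_measurable M" and "0 \<le> c"
    and le: "\<And>x. x \<in> space M \<Longrightarrow> \<bar>g x\<bar> \<le> c + \<bar>f x\<bar>"
  shows "decr_rearr M g v \<le> ennreal c + decr_rearr M f v"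
proof -
  \<comment> \<open>With \<open>c\<close> moved to the left by truncated subtraction, it suffices to
    compare with each level \<open>s\<close> admissible for \<open>f\<close>: then
    \<open>s + c\<close> is admissible for \<open>g\<close>.\<close>
  have "decr_rearr M g v - ennreal c \<le> decr_rearr M f v"
  proof (rule decr_rearr_ge)
    fix s :: real assume s: "0 < s" "emeasure M {x \<in> space M. s < \<bar>f x\<bar>} \<le> ennreal v"
    have "emeasure M {x \<in> space M. s + c < \<bar>g x\<bar>} \<le> emeasure M {x \<in> space M. s < \<bar>f x\<bar>}"
      using le by (intro emeasure_mono) fastforce+
    with s \<open>0 \<le> c\<close> have "decr_rearr M g v \<le> ennreal (s + c)"
      by (intro decr_rearr_le) auto
    then show "decr_rearr M g v - ennreal c \<le> ennreal s"
      using s \<open>0 \<le> c\<close> by (simp add: ennreal_minus_le_iff add.commute)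
  qed
  then show ?thesis by (simp add: ennreal_minus_le_iff)
qed

text \<open>One half of the K-functional formula for the couple of integrable and bounded functions:
  every splitting of \<open>g\<close> into a part bounded by \<open>c\<close> and an integrable part
  bounds \<open>s g\<^sup>*\<^sup>*(s)\<close>. The rearrangement of the integrable part is
  integrated over the whole half line, where the layer cake formula applies.\<close>

lemma nn_integral_decr_rearr_le:
  assumes "sigma_finite_measure M" and [measurable]: "f \<in> borel_measurable M" and "0 \<le> c" "0 < s"
    and le: "\<And>x. x \<in> space M \<Longrightarrow> \<bar>g x\<bar> \<le> c + \<bar>f x\<bar>"
  shows "(\<integral>\<^sup>+ v \<in> {0<..<s}. decr_rearr M g v \<partial>lborel) \<le> ennreal c * ennreal s + (\<integral>\<^sup>+ x. ennreal \<bar>f x\<bar> \<partial>M)"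
proof -
  have "(\<integral>\<^sup>+ v \<in> {0<..<s}. decr_rearr M g v \<partial>lborel)
    \<le> (\<integral>\<^sup>+ v. ennreal c * indicator {0<..<s} v + decr_rearr M f v * indicator {0<..} v \<partial>lborel)"
    using decr_rearr_le_add[of f M c g] assms
    by (intro nn_integral_mono) (auto split: split_indicator)
  also have "\<dots> = ennreal c * ennreal s + (\<integral>\<^sup>+ v \<in> {0<..}. decr_rearr M f v \<partial>lborel)"
    using \<open>0 < s\<close> by (subst nn_integral_add) (auto simp: nn_integral_cmult_indicator)
  finally show ?thesis by (simp add: nn_integral_decr_rearr assms)
qed

text \<open>The excess of \<open>f\<close> above the level \<open>f\<^sup>*(u)\<close> lives on a set of measure at most \<open>u\<close>,
  so its rearrangement vanishes beyond \<open>u\<close>.\<close>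

lemma nn_integral_excess_le:
  assumes "sigma_finite_measure M" and [measurable]: "f \<in> borel_measurable M" and "0 < u" "0 \<le> \<kappa>"
    and \<kappa>: "decr_rearr M f u = ennreal \<kappa>"
  shows "(\<integral>\<^sup>+ x. ennreal (max 0 (\<bar>f x\<bar> - \<kappa>)) \<partial>M) + ennreal \<kappa> * ennreal u
    \<le> (\<integral>\<^sup>+ v \<in> {0<..<u}. decr_rearr M f v \<partial>lborel)"
proof -
  define e where "e x = max 0 (\<bar>f x\<bar> - \<kappa>)" for x
  have [measurable]: "e \<in> borel_measurable M" unfolding e_def by measurable
  have lev: "{x \<in> space M. s < \<bar>e x\<bar>} = {x \<in> space M. s + \<kappa> < \<bar>f x\<bar>}" if "0 < s" for s
    using that by (auto simp: e_def)
  \<comment> \<open>Since \<open>s + \<kappa>\<close> exceeds \<open>f\<^sup>*(u)\<close>, some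
    admissible level \<open>s'\<close> lies below it, so \<open>e\<close> exceeds \<open>s\<close>
    only on a set of measure at most \<open>u\<close>. Levels must be positive, hence the limit
    \<open>s\<close> to 0.\<close>
  have zero: "decr_rearr M e v = 0" if "u \<le> v" for v
  proof -
    have "decr_rearr M e v \<le> 0 + ennreal s" if "0 < s" for s
    proof -
      have "\<not> decr_rearr M f u \<ge> ennreal (s + \<kappa>)"
        using \<kappa> \<open>0 \<le> \<kappa>\<close> that by (simp add: ennreal_le_iff2)
      then obtain s' where s': "0 < s'" "emeasure M {x \<in> space M. s' < \<bar>f x\<bar>} \<le> ennreal u" "s' < s + \<kappa>"
        using decr_rearr_ge[of M f u "ennreal (s + \<kappa>)"] by (meson ennreal_leI not_le)
      have "emeasure M {x \<in> space M. s + \<kappa> < \<bar>f x\<bar>} \<le> emeasure M {x \<in> space M. s' < \<bar>f x\<bar>}"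
        using s' by (intro emeasure_mono) auto
      also have "\<dots> \<le> ennreal v" using s' \<open>u \<le> v\<close> ennreal_leI order_trans by blast
      finally show ?thesis using that by (auto simp: lev intro: decr_rearr_le)
    qed
    then have "decr_rearr M e v \<le> 0" by (rule ennreal_le_epsilon)
    then show ?thesis by simp
  qed
  \<comment> \<open>A level \<open>s\<close> for \<open>f\<close> is a level
    \<open>s - \<kappa>\<close> for \<open>e\<close>; the slack \<open>d\<close> keeps the latter
    positive when \<open>s = \<kappa>\<close>.\<close>
  have below: "decr_rearr M e v + ennreal \<kappa> \<le> decr_rearr M f v" if "v < u" for v
  proof (rule decr_rearr_ge)
    fix s :: real assume s: "0 < s" "emeasure M {x \<in> space M. s < \<bar>f x\<bar>} \<le> ennreal v"
    have "ennreal \<kappa> \<le> decr_rearr M f v"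
      using antimonoD[OF antimono_decr_rearr, of v u M f] that \<kappa> by auto
    also have "\<dots> \<le> ennreal s" using s by (rule decr_rearr_le)
    finally have "\<kappa> \<le> s" using s by simp
    have "decr_rearr M e v \<le> ennreal (s - \<kappa>) + ennreal d" if "0 < d" for d
    proof -
      have "emeasure M {x \<in> space M. s - \<kappa> + d < \<bar>e x\<bar>} \<le> emeasure M {x \<in> space M. s < \<bar>f x\<bar>}"
        using that \<open>\<kappa> \<le> s\<close> by (subst lev) (auto intro!: emeasure_mono)
      then have "decr_rearr M e v \<le> ennreal (s - \<kappa> + d)"
        using that \<open>\<kappa> \<le> s\<close> s by (intro decr_rearr_le) auto
      then show ?thesis using that \<open>\<kappa> \<le> s\<close> by simp
    qed
    then have "decr_rearr M e v \<le> ennreal (s - \<kappa>)" by (rule ennreal_le_epsilon)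
    then have "decr_rearr M e v + ennreal \<kappa> \<le> ennreal (s - \<kappa>) + ennreal \<kappa>" by (intro add_mono) auto
    then show "decr_rearr M e v + ennreal \<kappa> \<le> ennreal s"
      using \<open>\<kappa> \<le> s\<close> \<open>0 \<le> \<kappa>\<close> by (simp flip: ennreal_plus)
  qed
  have "(\<integral>\<^sup>+ x. ennreal (e x) \<partial>M) = (\<integral>\<^sup>+ x. ennreal \<bar>e x\<bar> \<partial>M)"
    by (simp add: e_def)
  also have "\<dots> = (\<integral>\<^sup>+ v \<in> {0<..}. decr_rearr M e v \<partial>lborel)"
    by (simp add: nn_integral_decr_rearr assms)
  also have "\<dots> + ennreal \<kappa> * ennreal u =
      (\<integral>\<^sup>+ v. decr_rearr M e v * indicator {0<..} v + ennreal \<kappa> * indicator {0<..<u} v \<partial>lborel)"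
    using \<open>0 < u\<close> by (subst nn_integral_add) (auto simp: nn_integral_cmult_indicator)
  also have "\<dots> \<le> (\<integral>\<^sup>+ v \<in> {0<..<u}. decr_rearr M f v \<partial>lborel)"
    using zero below by (intro nn_integral_mono) (auto split: split_indicator)
  finally show ?thesis by (simp add: e_def)
qed

section \<open>The averaged rearrangement\<close>

lemma nn_integral_decr_rearr_eq_avg:
  assumes "0 < t"
  shows "(\<integral>\<^sup>+ v \<in> {0<..<t}. decr_rearr M f v \<partial>lborel) = ennreal t * avg_rearr M f t"
  using assms by (simp add: avg_rearr_def mult.assoc[symmetric] flip: ennreal_mult)

text \<open>Rescaling to the unit interval writes \<open>avg_rearr M f t\<close> as the integral of
  \<open>decr_rearr M f (t * v)\<close> over \<open>0 < v < 1\<close>, whose integrand decreases in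
  \<open>t\<close>.\<close>

lemma avg_rearr_antimono:
  assumes "0 < s" "s \<le> t"
  shows "avg_rearr M f t \<le> avg_rearr M f s"
proof -
  have eq: "avg_rearr M f t = (\<integral>\<^sup>+ v. decr_rearr M f (t * v) * indicator {0<..<1} v \<partial>lborel)"
    if "0 < t" for t
  proof -
    have "(\<integral>\<^sup>+ v \<in> {0<..<t}. decr_rearr M f v \<partial>lborel) =
        ennreal t * (\<integral>\<^sup>+ v. decr_rearr M f (t * v) * indicator {0<..<t} (t * v) \<partial>lborel)"
      using that by (subst nn_integral_real_affine[where c = t and t = 0]) auto
    also have "(\<lambda>v. indicator {0<..<t} (t * v) :: ennreal) = indicator {0<..<1}"
      using that by (auto simp: fun_eq_iff indicator_def zero_less_mult_iff)
    finally show ?thesis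
      using that by (simp add: avg_rearr_def mult.assoc[symmetric] flip: ennreal_mult)
  qed
  show ?thesis
    using assms unfolding eq[OF \<open>0 < s\<close>] eq[OF less_le_trans[OF assms]]
    by (intro nn_integral_mono)
      (auto split: split_indicator intro!: antimonoD[OF antimono_decr_rearr] mult_right_mono)
qed

lemma decr_rearr_le_avg_rearr:
  assumes "0 < t"
  shows "decr_rearr M f t \<le> avg_rearr M f t"
proof -
  have "ennreal t * decr_rearr M f t = (\<integral>\<^sup>+ v. decr_rearr M f t * indicator {0<..<t} v \<partial>lborel)"
    using assms by (simp add: nn_integral_cmult_indicator mult.commute)
  also have "\<dots> \<le> (\<integral>\<^sup>+ v \<in> {0<..<t}. decr_rearr M f v \<partial>lborel)"
    by (intro nn_integral_mono) (auto split: split_indicator intro: antimonoD[OF antimono_decr_rearr])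
  finally have "ennreal t * decr_rearr M f t \<le> ennreal t * avg_rearr M f t"
    using assms by (simp add: nn_integral_decr_rearr_eq_avg)
  then show ?thesis
    using assms by (simp add: ennreal_mult_le_mult_iff)
qed

lemma borel_measurable_avg_rearr [measurable]: "avg_rearr M f \<in> borel_measurable borel"
proof -
  \<comment> \<open>The moving endpoint becomes the indicator of a fixed planar set, so
    measurability of parameter integrals applies.\<close>
  have "avg_rearr M f = (\<lambda>t. ennreal (1 / t) *
      (\<integral>\<^sup>+ s. decr_rearr M f s * indicator {z. 0 < snd z \<and> snd z < fst z} (t, s) \<partial>lborel))"
    unfolding avg_rearr_def
    by (intro ext arg_cong2[where f = "(*)"] refl nn_integral_cong) (auto split: split_indicator)
  also have "\<dots> \<in> borel_measurable borel" by measurable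
  finally show ?thesis .
qed

text \<open>The level is \<open>f\<^sup>*(u)\<close>, a real number because it is dominated by the
  finite \<open>f\<^sup>*\<^sup>*(u)\<close>. This is the other half of the K-functional formula,
  with an optimal splitting.\<close>

lemma nn_integral_excess_le_avg:
  assumes "sigma_finite_measure M" "f \<in> borel_measurable M" "0 < u" "avg_rearr M f u < \<infinity>"
  obtains \<kappa> where "0 \<le> \<kappa>"
    "(\<integral>\<^sup>+ x. ennreal (max 0 (\<bar>f x\<bar> - \<kappa>)) \<partial>M) + ennreal \<kappa> * ennreal u \<le> ennreal u * avg_rearr M f u"
proof -
  have "decr_rearr M f u < \<infinity>"
    using decr_rearr_le_avg_rearr[of u M f] assms by auto
  then obtain \<kappa> where "0 \<le> \<kappa>" "decr_rearr M f u = ennreal \<kappa>"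
    by (cases "decr_rearr M f u") auto
  with nn_integral_excess_le[of M f u \<kappa>] assms that show thesis
    by (simp add: nn_integral_decr_rearr_eq_avg)
qed

section \<open>Integral operators and rearrangements\<close>

text \<open>On the excess of \<open>f\<close> over \<open>\<kappa>\<close> the bound
  \<open>h \<le> A\<close> is used, on the constant \<open>\<kappa>\<close> the bound on the
  integral of \<open>h\<close>. Applied to the kernel at a fixed boundary point, it gives the
  uniform bound on the trace.\<close>

lemma nn_integral_mult_le_avg_rearr:
  assumes "sigma_finite_measure M" and [measurable]: "f \<in> borel_measurable M" "h \<in> borel_measurable M"
    and h: "\<And>y. y \<in> space M \<Longrightarrow> 0 \<le> h y" "\<And>y. y \<in> space M \<Longrightarrow> h y \<le> A"
    and int: "(\<integral>\<^sup>+ y. ennreal (h y) \<partial>M) \<le> ennreal c" and "0 < A" "0 < c"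
    and fin: "avg_rearr M f (c / A) < \<infinity>"
  shows "(\<integral>\<^sup>+ y. ennreal (h y * \<bar>f y\<bar>) \<partial>M) \<le> ennreal c * avg_rearr M f (c / A)"
proof -
  obtain \<kappa> where \<kappa>: "0 \<le> \<kappa>" "(\<integral>\<^sup>+ x. ennreal (max 0 (\<bar>f x\<bar> - \<kappa>)) \<partial>M) + ennreal \<kappa> * ennreal (c / A)
      \<le> ennreal (c / A) * avg_rearr M f (c / A)"
    using nn_integral_excess_le_avg[OF assms(1,2) _ fin] \<open>0 < A\<close> \<open>0 < c\<close> by auto
  have "(\<integral>\<^sup>+ y. ennreal (h y * \<bar>f y\<bar>) \<partial>M) \<le>
      (\<integral>\<^sup>+ y. ennreal A * ennreal (max 0 (\<bar>f y\<bar> - \<kappa>)) + ennreal \<kappa> * ennreal (h y) \<partial>M)"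
  proof (intro nn_integral_mono)
    fix y assume y: "y \<in> space M"
    have "h y * \<bar>f y\<bar> \<le> h y * (max 0 (\<bar>f y\<bar> - \<kappa>) + \<kappa>)"
      using h[OF y] by (intro mult_left_mono) auto
    also have "\<dots> \<le> A * max 0 (\<bar>f y\<bar> - \<kappa>) + \<kappa> * h y"
      using h[OF y] mult_right_mono[of "h y" A "max 0 (\<bar>f y\<bar> - \<kappa>)"] by (simp add: algebra_simps)
    finally have "ennreal (h y * \<bar>f y\<bar>) \<le> ennreal (A * max 0 (\<bar>f y\<bar> - \<kappa>) + \<kappa> * h y)"
      by (rule ennreal_leI)
    also have "\<dots> = ennreal A * ennreal (max 0 (\<bar>f y\<bar> - \<kappa>)) + ennreal \<kappa> * ennreal (h y)"
      using \<open>0 < A\<close> \<kappa>(1) h[OF y] by (simp add: ennreal_mult' ennreal_plus)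
    finally show "ennreal (h y * \<bar>f y\<bar>) \<le>
        ennreal A * ennreal (max 0 (\<bar>f y\<bar> - \<kappa>)) + ennreal \<kappa> * ennreal (h y)" .
  qed
  also have "\<dots> = ennreal A * (\<integral>\<^sup>+ y. ennreal (max 0 (\<bar>f y\<bar> - \<kappa>)) \<partial>M) + ennreal \<kappa> * (\<integral>\<^sup>+ y. ennreal (h y) \<partial>M)"
    by (simp add: nn_integral_add nn_integral_cmult)
  also have "\<dots> \<le> ennreal A * (\<integral>\<^sup>+ y. ennreal (max 0 (\<bar>f y\<bar> - \<kappa>)) \<partial>M) + ennreal \<kappa> * ennreal c"
    by (intro add_mono mult_left_mono int) auto
  \<comment> \<open>The choice \<open>u = c / A\<close> gives both terms the common factor
    \<open>A\<close>, which reassembles the left side of the bound on the excess.\<close>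
  also have "ennreal c = ennreal A * ennreal (c / A)"
    using \<open>0 < A\<close> \<open>0 < c\<close> by (simp flip: ennreal_mult)
  also have "ennreal A * (\<integral>\<^sup>+ y. ennreal (max 0 (\<bar>f y\<bar> - \<kappa>)) \<partial>M) + ennreal \<kappa> * (ennreal A * ennreal (c / A)) =
      ennreal A * ((\<integral>\<^sup>+ y. ennreal (max 0 (\<bar>f y\<bar> - \<kappa>)) \<partial>M) + ennreal \<kappa> * ennreal (c / A))"
    by (simp add: algebra_simps)
  also have "\<dots> \<le> ennreal A * (ennreal (c / A) * avg_rearr M f (c / A))"
    by (intro mult_left_mono \<kappa>) auto
  also have "\<dots> = ennreal c * avg_rearr M f (c / A)"
    using \<open>0 < A\<close> \<open>0 < c\<close> by (simp add: mult.assoc[symmetric] flip: ennreal_mult)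
  finally show ?thesis .
qed

lemma avg_rearr_le_of_abs_le:
  assumes "0 < s" and le: "\<And>x. x \<in> space M \<Longrightarrow> ennreal \<bar>g x\<bar> \<le> c"
  shows "avg_rearr M g s \<le> c"
proof -
  \<comment> \<open>The slack \<open>e\<close> makes \<open>k + e\<close> an admissible positive
    level even for \<open>k = 0\<close>.\<close>
  have "decr_rearr M g v \<le> c + ennreal e" if "0 < e" for v e
  proof (cases c)
    case (real k)
    have "{x \<in> space M. k + e < \<bar>g x\<bar>} = {}"
      using le real that by fastforce
    then have "emeasure M {x \<in> space M. k + e < \<bar>g x\<bar>} \<le> ennreal v"
      by (simp only: emeasure_empty zero_le)
    then show ?thesis
      using decr_rearr_le[of "k + e" M g v] real that by (simp add: ennreal_plus)
  qed auto
  then have le': "decr_rearr M g v \<le> c" for v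
    by (rule ennreal_le_epsilon)
  have "(\<integral>\<^sup>+ v \<in> {0<..<s}. decr_rearr M g v \<partial>lborel) \<le> (\<integral>\<^sup>+ v. c * indicator {0<..<s} v \<partial>lborel)"
    using le' by (intro nn_integral_mono) (auto split: split_indicator)
  also have "\<dots> = ennreal s * c"
    using \<open>0 < s\<close> by (simp add: nn_integral_cmult_indicator mult.commute)
  finally show ?thesis
    using \<open>0 < s\<close> by (simp add: nn_integral_decr_rearr_eq_avg ennreal_mult_le_mult_iff)
qed

text \<open>The operator with kernel \<open>K\<close> has norm at most \<open>c\<close> on bounded
  functions and at most \<open>B\<close> on integrable ones. Splitting \<open>f\<close> optimally
  and applying one bound to each part estimates the K-functional of \<open>g\<close>.\<close>

lemma avg_rearr_kernel_le:
  fixes K :: "'a \<Rightarrow> 'b \<Rightarrow> real"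
  assumes M: "sigma_finite_measure M" and N: "sigma_finite_measure N"
    and K [measurable]: "case_prod K \<in> borel_measurable (M \<Otimes>\<^sub>M N)"
    and f [measurable]: "f \<in> borel_measurable N" and g [measurable]: "g \<in> borel_measurable M"
    and K_nonneg: "\<And>x y. x \<in> space M \<Longrightarrow> y \<in> space N \<Longrightarrow> 0 \<le> K x y"
    and int_N: "\<And>x. x \<in> space M \<Longrightarrow> (\<integral>\<^sup>+ y. ennreal (K x y) \<partial>N) \<le> ennreal c"
    and int_M: "\<And>y. y \<in> space N \<Longrightarrow> (\<integral>\<^sup>+ x. ennreal (K x y) \<partial>M) \<le> ennreal B"
    and pos: "0 < B" "0 < c" "0 < s"
    and fin: "avg_rearr N f (c / B * s) < \<infinity>"
    and le: "\<And>x. x \<in> space M \<Longrightarrow> ennreal \<bar>g x\<bar> \<le> (\<integral>\<^sup>+ y. ennreal (K x y * \<bar>f y\<bar>) \<partial>N)"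
  shows "avg_rearr M g s \<le> ennreal c * avg_rearr N f (c / B * s)"
proof -
  interpret M: sigma_finite_measure M by fact
  interpret N: sigma_finite_measure N by fact
  interpret P: pair_sigma_finite M N ..
  \<comment> \<open>Chosen so that \<open>B * u = c * s\<close>: the bounded part contributes
    \<open>c * \<kappa> * s\<close>, the excess carries the factor \<open>B\<close>, and the two now
    combine.\<close>
  define u where "u = c / B * s"
  have "0 < u" "B * u = c * s" using pos by (auto simp: u_def)
  obtain \<kappa> where \<kappa>: "0 \<le> \<kappa>" "(\<integral>\<^sup>+ x. ennreal (max 0 (\<bar>f x\<bar> - \<kappa>)) \<partial>N) + ennreal \<kappa> * ennreal u
      \<le> ennreal u * avg_rearr N f u"
    using nn_integral_excess_le_avg[OF N f \<open>0 < u\<close>] fin by (auto simp: u_def)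
  define e where "e y = max 0 (\<bar>f y\<bar> - \<kappa>)" for y
  have [measurable]: "e \<in> borel_measurable N" unfolding e_def by measurable
  have e_nonneg: "0 \<le> e y" for y by (simp add: e_def)
  \<comment> \<open>The bounded part of \<open>f\<close> contributes at most
    \<open>c * \<kappa>\<close> to \<open>\<bar>g\<bar>\<close>, so what exceeds this level comes
    from the excess \<open>e\<close> alone.\<close>
  define g0 where "g0 x = max 0 (\<bar>g x\<bar> - c * \<kappa>)" for x
  have [measurable]: "g0 \<in> borel_measurable M" unfolding g0_def by measurable
  have g0_le: "ennreal \<bar>g0 x\<bar> \<le> (\<integral>\<^sup>+ y. ennreal (K x y) * ennreal (e y) \<partial>N)" if x: "x \<in> space M" for x
  proof -
    have [measurable]: "K x \<in> borel_measurable N"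
      using measurable_compose[OF measurable_Pair1'[OF x] K] by simp
    have "ennreal \<bar>g x\<bar> \<le> (\<integral>\<^sup>+ y. ennreal (K x y * \<bar>f y\<bar>) \<partial>N)"
      by (rule le[OF x])
    also have "\<dots> \<le> (\<integral>\<^sup>+ y. ennreal (K x y) * ennreal (e y) + ennreal \<kappa> * ennreal (K x y) \<partial>N)"
    proof (intro nn_integral_mono)
      fix y assume y: "y \<in> space N"
      have "K x y * \<bar>f y\<bar> \<le> K x y * (e y + \<kappa>)"
        using K_nonneg[OF x y] by (intro mult_left_mono) (auto simp: e_def)
      then have "ennreal (K x y * \<bar>f y\<bar>) \<le> ennreal (K x y * e y + \<kappa> * K x y)"
        by (intro ennreal_leI) (simp add: algebra_simps)
      also have "\<dots> = ennreal (K x y) * ennreal (e y) + ennreal \<kappa> * ennreal (K x y)"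
        using K_nonneg[OF x y] e_nonneg \<kappa>(1) by (simp add: ennreal_mult ennreal_plus)
      finally show "ennreal (K x y * \<bar>f y\<bar>) \<le> ennreal (K x y) * ennreal (e y) + ennreal \<kappa> * ennreal (K x y)" .
    qed
    also have "\<dots> = (\<integral>\<^sup>+ y. ennreal (K x y) * ennreal (e y) \<partial>N) + ennreal \<kappa> * (\<integral>\<^sup>+ y. ennreal (K x y) \<partial>N)"
      by (simp add: nn_integral_add nn_integral_cmult)
    also have "\<dots> \<le> (\<integral>\<^sup>+ y. ennreal (K x y) * ennreal (e y) \<partial>N) + ennreal \<kappa> * ennreal c"
      by (intro add_mono mult_left_mono int_N x) auto
    finally have "ennreal \<bar>g x\<bar> \<le> ennreal (c * \<kappa>) + (\<integral>\<^sup>+ y. ennreal (K x y) * ennreal (e y) \<partial>N)"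
      using pos \<kappa>(1) by (simp add: ennreal_mult mult.commute add.commute)
    then have "ennreal \<bar>g x\<bar> - ennreal (c * \<kappa>) \<le> (\<integral>\<^sup>+ y. ennreal (K x y) * ennreal (e y) \<partial>N)"
      by (simp add: ennreal_minus_le_iff)
    moreover have "ennreal \<bar>g0 x\<bar> = ennreal \<bar>g x\<bar> - ennreal (c * \<kappa>)"
      using pos \<kappa>(1) by (simp add: g0_def ennreal_minus max_def ennreal_neg)
    ultimately show ?thesis by simp
  qed
  \<comment> \<open>Tonelli's theorem lets the integral in \<open>x\<close> act on the kernel first,
    where it is at most \<open>B\<close>.\<close>
  have "(\<integral>\<^sup>+ x. ennreal \<bar>g0 x\<bar> \<partial>M) \<le> (\<integral>\<^sup>+ x. (\<integral>\<^sup>+ y. ennreal (K x y) * ennreal (e y) \<partial>N) \<partial>M)"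
    by (intro nn_integral_mono g0_le)
  also have "\<dots> = (\<integral>\<^sup>+ y. (\<integral>\<^sup>+ x. ennreal (K x y) * ennreal (e y) \<partial>M) \<partial>N)"
    by (intro P.Fubini'[symmetric]) measurable
  also have "\<dots> \<le> (\<integral>\<^sup>+ y. ennreal B * ennreal (e y) \<partial>N)"
  proof (intro nn_integral_mono)
    fix y assume y: "y \<in> space N"
    have [measurable]: "(\<lambda>x. K x y) \<in> borel_measurable M"
      using measurable_compose[OF measurable_Pair2'[OF y] K] by simp
    show "(\<integral>\<^sup>+ x. ennreal (K x y) * ennreal (e y) \<partial>M) \<le> ennreal B * ennreal (e y)"
      by (simp add: nn_integral_multc int_M y mult_right_mono)
  qed
  also have "\<dots> = ennreal B * (\<integral>\<^sup>+ y. ennreal (e y) \<partial>N)"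
    by (simp add: nn_integral_cmult)
  finally have g0: "(\<integral>\<^sup>+ x. ennreal \<bar>g0 x\<bar> \<partial>M) \<le> ennreal B * (\<integral>\<^sup>+ y. ennreal (e y) \<partial>N)" .
  have "ennreal s * avg_rearr M g s \<le> ennreal (c * \<kappa>) * ennreal s + (\<integral>\<^sup>+ x. ennreal \<bar>g0 x\<bar> \<partial>M)"
    using pos \<kappa>(1) unfolding nn_integral_decr_rearr_eq_avg[OF \<open>0 < s\<close>, symmetric]
    by (intro nn_integral_decr_rearr_le M) (auto simp: g0_def)
  also have "\<dots> \<le> ennreal (c * \<kappa>) * ennreal s + ennreal B * (\<integral>\<^sup>+ y. ennreal (e y) \<partial>N)"
    by (intro add_mono g0) auto
  also have "ennreal (c * \<kappa>) * ennreal s = ennreal B * (ennreal \<kappa> * ennreal u)"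
    using \<open>B * u = c * s\<close> \<open>0 < u\<close> pos \<kappa>(1) by (simp add: mult.left_commute mult.commute flip: ennreal_mult)
  also have "ennreal B * (ennreal \<kappa> * ennreal u) + ennreal B * (\<integral>\<^sup>+ y. ennreal (e y) \<partial>N) =
      ennreal B * ((\<integral>\<^sup>+ y. ennreal (e y) \<partial>N) + ennreal \<kappa> * ennreal u)"
    by (simp add: algebra_simps)
  also have "\<dots> \<le> ennreal B * (ennreal u * avg_rearr N f u)"
    using \<kappa>(2) by (intro mult_left_mono) (auto simp: e_def)
  also have "\<dots> = ennreal s * (ennreal c * avg_rearr N f u)"
    using \<open>B * u = c * s\<close> \<open>0 < u\<close> pos by (simp add: mult.assoc[symmetric] mult.commute flip: ennreal_mult)
  finally show ?thesis
    using \<open>0 < s\<close> by (simp add: ennreal_mult_le_mult_iff u_def)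
qed

section \<open>Powers of extended reals and comparison of Lorentz norms\<close>

lemma ennreal_powr_mono:
  assumes "x \<le> y" "0 \<le> p"
  shows "ennreal_powr x p \<le> ennreal_powr y p"
  using assms
  by (cases x; cases y) (auto simp: ennreal_powr_def powr_mono2 top_unique intro!: ennreal_leI)

lemma ennreal_powr_cmult:
  assumes "0 < c"
  shows "ennreal_powr (ennreal c * x) p = ennreal (c powr p) * ennreal_powr x p"
  using assms
  by (cases x) (auto simp: ennreal_powr_def powr_mult ennreal_mult_top simp flip: ennreal_mult)

lemma ennreal_powr_eq_top_iff: "ennreal_powr x p = \<infinity> \<longleftrightarrow> x = \<infinity>"
  by (simp add: ennreal_powr_def)

lemma borel_measurable_ennreal_powr [measurable]:
  assumes [measurable]: "f \<in> borel_measurable M"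
  shows "(\<lambda>x. ennreal_powr (f x) p) \<in> borel_measurable M"
  unfolding ennreal_powr_def by measurable

lemma nn_integral_powr_from_0:
  fixes a q :: real
  assumes "0 < q" "0 \<le> a"
  shows "(\<integral>\<^sup>+ s. ennreal (s powr (q - 1)) * indicator {0<..a} s \<partial>lborel) = ennreal (a powr q / q)"
proof -
  have "((\<lambda>s. s powr (q - 1)) has_integral a powr q / q) {0..a}"
    using has_integral_powr_from_0[of "q - 1" a] assms by simp
  then have "(\<integral>\<^sup>+ s. ennreal (indicator {0..a} s * s powr (q - 1)) \<partial>lborel) = ennreal (a powr q / q)"
    by (intro nn_integral_has_integral_lebesgue) auto
  moreover have "ennreal (s powr (q - 1)) * indicator {0<..a} s = ennreal (indicator {0..a} s * s powr (q - 1))" for s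
    by (auto split: split_indicator)
  ultimately show ?thesis by simp
qed

lemma lorentz_integrand_eq:
  assumes "0 < t"
  shows "ennreal_powr (ennreal (t powr (1 / d)) * x) p * ennreal (1 / t) =
    ennreal (t powr (p / d - 1)) * ennreal_powr x p"
proof -
  have "ennreal_powr (ennreal (t powr (1 / d)) * x) p * ennreal (1 / t) =
      ennreal (t powr (p / d)) * ennreal (1 / t) * ennreal_powr x p"
    using assms by (simp add: ennreal_powr_cmult powr_powr) (simp add: ac_simps)
  also have "ennreal (t powr (p / d)) * ennreal (1 / t) = ennreal (t powr (p / d - 1))"
    using assms by (simp add: powr_diff flip: ennreal_mult)
  finally show ?thesis .
qed

text \<open>On \<open>0 < t \<le> a\<close> the average is at least its value at \<open>a\<close>,
  and the weight \<open>t powr (p / d - 1)\<close> has integral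
  \<open>a powr (p / d) / (p / d)\<close> there. A single value is thus controlled by the
  norm.\<close>

lemma powr_mult_avg_rearr_le:
  assumes "0 < d" "0 < p" "0 < a"
  shows "ennreal (a powr (p / d) / (p / d)) * ennreal_powr (avg_rearr M f a) p \<le>
    (\<integral>\<^sup>+ t \<in> {0<..}. ennreal_powr (ennreal (t powr (1 / d)) * avg_rearr M f t) p * ennreal (1 / t) \<partial>lborel)"
proof -
  have "ennreal (a powr (p / d) / (p / d)) * ennreal_powr (avg_rearr M f a) p =
      (\<integral>\<^sup>+ t. ennreal (t powr (p / d - 1)) * indicator {0<..a} t * ennreal_powr (avg_rearr M f a) p \<partial>lborel)"
    using assms by (simp add: nn_integral_multc nn_integral_powr_from_0)
  also have "\<dots> \<le> (\<integral>\<^sup>+ t \<in> {0<..}. ennreal_powr (ennreal (t powr (1 / d)) * avg_rearr M f t) p * ennreal (1 / t) \<partial>lborel)"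
    using assms
    by (intro nn_integral_mono)
      (auto simp: lorentz_integrand_eq intro!: mult_left_mono ennreal_powr_mono avg_rearr_antimono split: split_indicator)
  finally show ?thesis .
qed

text \<open>Supplies the finiteness that the splitting at a real level requires. For infinite
  \<open>r\<close> the value is one term of the supremum; otherwise the preceding bound
  applies.\<close>

lemma avg_rearr_finite_of_lorentz_norm_finite:
  assumes "0 < d" "1 \<le> r" "lorentz_norm d r M f < \<infinity>" "0 < a"
  shows "avg_rearr M f a < \<infinity>"
proof (cases "r = \<infinity>")
  case True
  have "ennreal (a powr (1 / d)) * avg_rearr M f a \<le> lorentz_norm d r M f"
    using True \<open>0 < a\<close> by (auto simp: lorentz_norm_def intro: SUP_upper)
  also have "\<dots> < \<infinity>" by fact
  finally show ?thesis using \<open>0 < a\<close> by (auto simp: ennreal_mult_less_top)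
next
  case False
  define p where "p = enn2real r"
  have "1 \<le> p" using False \<open>1 \<le> r\<close> unfolding p_def by (cases r) auto
  define J where "J = (\<integral>\<^sup>+ t \<in> {0<..}. ennreal_powr (ennreal (t powr (1 / d)) * avg_rearr M f t) p * ennreal (1 / t) \<partial>lborel)"
  have "ennreal_powr J (1 / p) \<noteq> \<infinity>"
    using assms(3) False by (simp add: lorentz_norm_def p_def J_def)
  then have "J < \<infinity>"
    by (cases J) (auto simp: ennreal_powr_def)
  moreover have "ennreal (a powr (p / d) / (p / d)) * ennreal_powr (avg_rearr M f a) p \<le> J"
    unfolding J_def using assms \<open>1 \<le> p\<close> by (intro powr_mult_avg_rearr_le) auto
  ultimately have "ennreal (a powr (p / d) / (p / d)) * ennreal_powr (avg_rearr M f a) p < \<infinity>"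
    by (rule le_less_trans[rotated])
  then have "ennreal_powr (avg_rearr M f a) p < \<infinity>"
    using assms \<open>1 \<le> p\<close> by (auto simp: ennreal_mult_less_top)
  then show ?thesis
    by (metis ennreal_powr_eq_top_iff infinity_ennreal_def less_top)
qed

text \<open>Passes from the pointwise comparison of averages to norms. In \<open>1 + d2 / d1\<close>
  the first summand comes from the range \<open>s > a / b\<close>, the second from
  \<open>s \<le> a / b\<close>.\<close>

lemma lorentz_norm_le_of_avg_rearr_le:
  fixes M :: "'a measure" and N :: "'b measure"
  assumes d: "0 < d1" "d1 < d2" and "1 \<le> r" and pos: "0 < a" "0 < b" "0 < c"
    and le: "\<And>s. 0 < s \<Longrightarrow> avg_rearr M g s \<le> ennreal c * avg_rearr N f (max a (b * s))"
  shows "lorentz_norm d2 r M g \<le>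
    ennreal (c * (1 + d2 / d1) * (b powr (- (1 / d2)) * a powr (1 / d2 - 1 / d1))) * lorentz_norm d1 r N f"
proof -
  \<comment> \<open>The quotient of \<open>s powr (1 / d2)\<close> by
    \<open>(b * s) powr (1 / d1)\<close> at \<open>s = a / b\<close>; as \<open>d1 < d2\<close>, the
    quotient is largest there on the range \<open>b * s \<ge> a\<close>.\<close>
  define Q where "Q = b powr (- (1 / d2)) * a powr (1 / d2 - 1 / d1)"
  have "0 < Q" using pos by (simp add: Q_def)
  have Q: "s powr (1 / d2) \<le> Q * (b * s) powr (1 / d1)" if "a \<le> b * s" "0 < s" for s
  proof -
    have "(b * s) powr (1 / d2 - 1 / d1) \<le> a powr (1 / d2 - 1 / d1)"
      using that pos d by (intro powr_mono2') (auto simp: field_simps)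
    then have "b powr (- (1 / d2)) * ((b * s) powr (1 / d2 - 1 / d1) * (b * s) powr (1 / d1)) \<le>
        b powr (- (1 / d2)) * (a powr (1 / d2 - 1 / d1) * (b * s) powr (1 / d1))"
      by (intro mult_left_mono mult_right_mono) auto
    moreover have "b powr (- (1 / d2)) * ((b * s) powr (1 / d2 - 1 / d1) * (b * s) powr (1 / d1)) = s powr (1 / d2)"
      using pos that by (simp add: powr_add[symmetric] powr_minus) (simp add: powr_mult)
    ultimately show ?thesis by (simp add: Q_def mult.assoc)
  qed
  show ?thesis
  proof (cases "r = \<infinity>")
    case True
    have "ennreal (s powr (1 / d2)) * avg_rearr M g s \<le> ennreal (c * Q) * lorentz_norm d1 r N f"
      if "0 < s" for s
    proof -
      \<comment> \<open>Since \<open>s \<le> w / b\<close> and \<open>w \<ge> a\<close>, the bound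
        by \<open>Q\<close> at \<open>w / b\<close> covers both ranges at once.\<close>
      define w where "w = max a (b * s)"
      have w: "0 < w" "a \<le> w" "b * s \<le> w" using pos by (auto simp: w_def)
      have "s powr (1 / d2) \<le> (w / b) powr (1 / d2)"
        using w pos d that by (intro powr_mono2) (auto simp: field_simps)
      also have "\<dots> \<le> Q * w powr (1 / d1)"
        using Q[of "w / b"] w pos by simp
      finally have s: "s powr (1 / d2) \<le> Q * w powr (1 / d1)" .
      have "ennreal (s powr (1 / d2)) * avg_rearr M g s \<le>
          ennreal (Q * w powr (1 / d1)) * (ennreal c * avg_rearr N f w)"
        using le[OF that] by (intro mult_mono ennreal_leI s) (auto simp: w_def)
      also have "\<dots> = ennreal (c * Q) * (ennreal (w powr (1 / d1)) * avg_rearr N f w)"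
        using pos \<open>0 < Q\<close> by (simp add: ennreal_mult ac_simps)
      also have "\<dots> \<le> ennreal (c * Q) * lorentz_norm d1 r N f"
        using True w by (auto simp: lorentz_norm_def intro!: mult_left_mono SUP_upper)
      finally show ?thesis .
    qed
    then have "lorentz_norm d2 r M g \<le> ennreal (c * Q) * lorentz_norm d1 r N f"
      using True by (auto simp: lorentz_norm_def[of d2] intro: SUP_least)
    also have "\<dots> \<le> ennreal (c * (1 + d2 / d1) * Q) * lorentz_norm d1 r N f"
      using pos d \<open>0 < Q\<close> by (intro mult_right_mono ennreal_leI) auto
    finally show ?thesis by (simp add: Q_def)
  next
    case False
    define p where "p = enn2real r"
    have "1 \<le> p" using False \<open>1 \<le> r\<close> unfolding p_def by (cases r) auto
    define I where "I d (L :: real \<Rightarrow> ennreal) =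
      (\<integral>\<^sup>+ t \<in> {0<..}. ennreal_powr (ennreal (t powr (1 / d)) * L t) p * ennreal (1 / t) \<partial>lborel)" for d L
    have norm: "lorentz_norm d2 r M g = ennreal_powr (I d2 (avg_rearr M g)) (1 / p)"
      "lorentz_norm d1 r N f = ennreal_powr (I d1 (avg_rearr N f)) (1 / p)"
      using False by (simp_all add: lorentz_norm_def I_def p_def)
    define F where "F = avg_rearr N f"
    have [measurable]: "F \<in> borel_measurable borel" by (simp add: F_def)
    \<comment> \<open>The indicator is included so that the substitution \<open>u = b * s\<close>
      can be made on the whole line.\<close>
    define H where "H t = ennreal_powr (ennreal (t powr (1 / d1)) * F t) p * ennreal (1 / t) * indicator {0<..} t" for t
    have [measurable]: "H \<in> borel_measurable borel" unfolding H_def by measurable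
    define k where "k = (c * Q) powr p"
    have "0 < k" using pos \<open>0 < Q\<close> by (simp add: k_def)
    \<comment> \<open>Contribution of \<open>s \<le> a / b\<close>, where the average of
      \<open>g\<close> is at most \<open>c * F a\<close>. The weights for \<open>d2\<close> on
      \<open>(0, a / b]\<close> and for \<open>d1\<close> on \<open>(0, a]\<close> have integrals
      whose ratio is \<open>Q powr p * (d2 / d1)\<close>.\<close>
    have near: "ennreal ((a / b) powr (p / d2) / (p / d2)) * (ennreal (c powr p) * ennreal_powr (F a) p) \<le>
        ennreal (k * (d2 / d1)) * I d1 F"
    proof -
      have "(a / b) powr (p / d2) = Q powr p * a powr (p / d1)"
      proof -
        have "Q powr p * a powr (p / d1) = b powr (- (p / d2)) * (a powr ((1 / d2 - 1 / d1) * p) * a powr (p / d1))"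
          using pos by (simp add: Q_def powr_mult powr_powr)
        also have "a powr ((1 / d2 - 1 / d1) * p) * a powr (p / d1) = a powr (p / d2)"
          by (simp add: powr_add[symmetric] left_diff_distrib)
        finally show ?thesis
          using pos by (simp add: powr_divide powr_minus_divide)
      qed
      then have eq: "(a / b) powr (p / d2) / (p / d2) * c powr p = k * (d2 / d1) * (a powr (p / d1) / (p / d1))"
        using pos d \<open>1 \<le> p\<close> \<open>0 < Q\<close> by (simp add: k_def powr_mult)
      have "ennreal ((a / b) powr (p / d2) / (p / d2)) * (ennreal (c powr p) * ennreal_powr (F a) p) =
          ennreal ((a / b) powr (p / d2) / (p / d2) * c powr p) * ennreal_powr (F a) p"
        using d \<open>1 \<le> p\<close> by (subst ennreal_mult) (auto simp: mult.assoc)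
      also have "\<dots> = ennreal (k * (d2 / d1)) * (ennreal (a powr (p / d1) / (p / d1)) * ennreal_powr (F a) p)"
        unfolding eq using d \<open>1 \<le> p\<close> \<open>0 < k\<close> by (subst ennreal_mult) (auto simp: mult.assoc)
      also have "\<dots> \<le> ennreal (k * (d2 / d1)) * I d1 F"
        unfolding I_def F_def using d pos \<open>1 \<le> p\<close> by (intro mult_left_mono powr_mult_avg_rearr_le) auto
      finally show ?thesis .
    qed
    have "I d2 (avg_rearr M g) \<le>
        (\<integral>\<^sup>+ s. ennreal (s powr (p / d2 - 1)) * indicator {0<..a / b} s * (ennreal (c powr p) * ennreal_powr (F a) p) +
          ennreal k * (ennreal b * H (0 + b * s)) \<partial>lborel)"
      unfolding I_def
    proof (intro nn_integral_mono)
      fix s :: real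
      show "ennreal_powr (ennreal (s powr (1 / d2)) * avg_rearr M g s) p * ennreal (1 / s) * indicator {0<..} s \<le>
        ennreal (s powr (p / d2 - 1)) * indicator {0<..a / b} s * (ennreal (c powr p) * ennreal_powr (F a) p) +
          ennreal k * (ennreal b * H (0 + b * s))"
      proof (cases "0 < s")
        case s: True
        show ?thesis
        proof (cases "s \<le> a / b")
          case True
          then have "max a (b * s) = a" using pos by (auto simp: field_simps)
          with le[OF s] have "ennreal_powr (avg_rearr M g s) p \<le> ennreal_powr (ennreal c * F a) p"
            using \<open>1 \<le> p\<close> by (intro ennreal_powr_mono) (auto simp: F_def)
          also have "\<dots> = ennreal (c powr p) * ennreal_powr (F a) p"
            using pos by (simp add: ennreal_powr_cmult)
          finally have "ennreal_powr (ennreal (s powr (1 / d2)) * avg_rearr M g s) p * ennreal (1 / s) \<le>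
              ennreal (s powr (p / d2 - 1)) * (ennreal (c powr p) * ennreal_powr (F a) p)"
            unfolding lorentz_integrand_eq[OF s] by (intro mult_left_mono) auto
          with True s show ?thesis by (simp add: add_increasing2)
        next
          case far: False
          then have "a \<le> b * s" using pos by (auto simp: field_simps)
          then have "ennreal (s powr (1 / d2)) * avg_rearr M g s \<le>
              ennreal (Q * (b * s) powr (1 / d1)) * (ennreal c * F (b * s))"
            using le[OF s] by (intro mult_mono ennreal_leI Q s) (auto simp: F_def)
          also have "\<dots> = ennreal (c * Q) * (ennreal ((b * s) powr (1 / d1)) * F (b * s))"
            using pos \<open>0 < Q\<close> by (simp add: ennreal_mult ac_simps)
          finally have "ennreal_powr (ennreal (s powr (1 / d2)) * avg_rearr M g s) p \<le>
              ennreal_powr (ennreal (c * Q) * (ennreal ((b * s) powr (1 / d1)) * F (b * s))) p"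
            using \<open>1 \<le> p\<close> by (intro ennreal_powr_mono) auto
          also have "\<dots> = ennreal k * ennreal_powr (ennreal ((b * s) powr (1 / d1)) * F (b * s)) p"
            using pos \<open>0 < Q\<close> by (simp add: ennreal_powr_cmult k_def)
          finally have "ennreal_powr (ennreal (s powr (1 / d2)) * avg_rearr M g s) p * ennreal (1 / s) \<le>
              ennreal k * ennreal_powr (ennreal ((b * s) powr (1 / d1)) * F (b * s)) p * ennreal (1 / s)"
            by (intro mult_right_mono) auto
          also have "\<dots> = ennreal k * (ennreal b * H (0 + b * s))"
          proof -
            \<comment> \<open>Scale invariance of the measure \<open>ds / s\<close>: the factor
              \<open>b\<close> is the Jacobian of the later substitution.\<close>
            have "ennreal (1 / s) = ennreal b * ennreal (1 / (b * s))"
              using pos s by (simp flip: ennreal_mult)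
            then show ?thesis
              using s pos by (simp add: H_def) (simp add: ac_simps)
          qed
          finally show ?thesis
            using far s by simp
        qed
      qed auto
    qed
    also have "\<dots> = ennreal ((a / b) powr (p / d2) / (p / d2)) * (ennreal (c powr p) * ennreal_powr (F a) p) +
        ennreal k * (ennreal b * (\<integral>\<^sup>+ s. H (0 + b * s) \<partial>lborel))"
      using d pos \<open>1 \<le> p\<close>
      by (simp add: nn_integral_add nn_integral_cmult nn_integral_multc nn_integral_powr_from_0)
    also have "ennreal b * (\<integral>\<^sup>+ s. H (0 + b * s) \<partial>lborel) = I d1 F"
      using nn_integral_real_affine[of H b 0] pos by (simp add: I_def H_def)
    also have "ennreal ((a / b) powr (p / d2) / (p / d2)) * (ennreal (c powr p) * ennreal_powr (F a) p) +
        ennreal k * I d1 F \<le> ennreal (k * (d2 / d1)) * I d1 F + ennreal k * I d1 F"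
      by (intro add_mono near) auto
    also have "\<dots> = ennreal (k * (1 + d2 / d1)) * I d1 F"
      using d \<open>0 < k\<close> by (simp add: distrib_left ennreal_plus distrib_right add.commute)
    also have "\<dots> \<le> ennreal ((c * (1 + d2 / d1) * Q) powr p) * I d1 F"
    proof (intro mult_right_mono ennreal_leI)
      \<comment> \<open>As the base is at least 1 and \<open>p \<ge> 1\<close>, the factor may be
        raised to the power \<open>p\<close>; the root of order \<open>p\<close> then leaves a
        constant independent of \<open>r\<close>.\<close>
      have "(1 + d2 / d1) powr 1 \<le> (1 + d2 / d1) powr p"
        using d \<open>1 \<le> p\<close> by (intro powr_mono) auto
      then have "k * (1 + d2 / d1) \<le> k * (1 + d2 / d1) powr p"
        using \<open>0 < k\<close> d by (intro mult_left_mono) auto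
      also have "\<dots> = (c * (1 + d2 / d1) * Q) powr p"
        using pos d \<open>0 < Q\<close> by (simp add: k_def powr_mult)
      finally show "k * (1 + d2 / d1) \<le> (c * (1 + d2 / d1) * Q) powr p" .
    qed auto
    finally have "ennreal_powr (I d2 (avg_rearr M g)) (1 / p) \<le>
        ennreal_powr (ennreal ((c * (1 + d2 / d1) * Q) powr p) * I d1 F) (1 / p)"
      using \<open>1 \<le> p\<close> by (intro ennreal_powr_mono) auto
    moreover have "ennreal_powr (ennreal (x powr p) * J) (1 / p) = ennreal x * ennreal_powr J (1 / p)"
      if "0 < x" for x J
      using that \<open>1 \<le> p\<close> by (subst ennreal_powr_cmult) (simp_all add: powr_powr)
    moreover have "0 < c * (1 + d2 / d1) * Q"
      using pos d \<open>0 < Q\<close> by (intro mult_pos_pos add_pos_pos) auto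
    ultimately show ?thesis by (simp add: norm F_def flip: Q_def)
  qed
qed

section \<open>Gaussian integrals and the Neumann kernel on the boundary\<close>

lemma sigma_finite_completion:
  assumes "sigma_finite_measure M"
  shows "sigma_finite_measure (completion M)"
proof -
  interpret sigma_finite_measure M by fact
  obtain A where "countable A" "A \<subseteq> sets M" "\<Union>A = space M" "\<forall>a\<in>A. emeasure M a \<noteq> \<infinity>"
    using sigma_finite_countable by auto
  then show ?thesis
    by (intro sigma_finite_measure.intro exI[of _ A])
      (auto simp: main_part_sets)
qed

text \<open>The exponential factors over the coordinates, and each factor is
  \<open>sqrt (4 * pi * t)\<close> times a normal density of variance \<open>2 * t\<close>.\<close>

lemma nn_integral_gaussian:
  fixes z :: "'a :: euclidean_space"
  assumes "0 < t"
  shows "(\<integral>\<^sup>+ y. ennreal (exp (- ((norm (z - y))\<^sup>2 / (4 * t)))) \<partial>lborel) =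
    ennreal ((4 * pi * t) powr (real DIM('a) / 2))"
proof -
  have one: "(\<integral>\<^sup>+ x. ennreal (exp (- ((\<mu> - x)\<^sup>2 / (4 * t)))) \<partial>lborel) = ennreal (sqrt (4 * pi * t))" for \<mu> :: real
  proof -
    have "exp (- ((\<mu> - x)\<^sup>2 / (4 * t))) = sqrt (4 * pi * t) * normal_density \<mu> (sqrt (2 * t)) x" for x
      using assms by (simp add: normal_density_def power2_commute mult.assoc)
    then have "(\<integral>\<^sup>+ x. ennreal (exp (- ((\<mu> - x)\<^sup>2 / (4 * t)))) \<partial>lborel) =
        ennreal (sqrt (4 * pi * t)) * (\<integral>\<^sup>+ x. ennreal (normal_density \<mu> (sqrt (2 * t)) x) \<partial>lborel)"
      using assms by (simp add: ennreal_mult nn_integral_cmult)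
    also have "(\<integral>\<^sup>+ x. ennreal (normal_density \<mu> (sqrt (2 * t)) x) \<partial>lborel) = 1"
      using assms by (subst nn_integral_eq_integral) auto
    finally show ?thesis by simp
  qed
  have "exp (- ((norm (z - y))\<^sup>2 / (4 * t))) = (\<Prod>b\<in>Basis. exp (- ((z \<bullet> b - y \<bullet> b)\<^sup>2 / (4 * t))))" for y
  proof -
    have "(norm (z - y))\<^sup>2 = (\<Sum>b\<in>Basis. (z \<bullet> b - y \<bullet> b)\<^sup>2)"
      unfolding power2_norm_eq_inner euclidean_inner[of "z - y" "z - y"]
      by (simp only: inner_diff_left power2_eq_square)
    then show ?thesis by (simp add: exp_sum[symmetric] sum_divide_distrib sum_negf)
  qed
  then have "(\<integral>\<^sup>+ y. ennreal (exp (- ((norm (z - y))\<^sup>2 / (4 * t)))) \<partial>lborel) =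
      (\<integral>\<^sup>+ y. (\<Prod>b\<in>Basis. ennreal (exp (- ((z \<bullet> b - y \<bullet> b)\<^sup>2 / (4 * t))))) \<partial>lborel)"
    by (simp add: prod_ennreal)
  also have "\<dots> = (\<Prod>b\<in>(Basis :: 'a set). ennreal (sqrt (4 * pi * t)))"
    by (subst nn_integral_lborel_prod) (auto simp: one)
  also have "\<dots> = ennreal (sqrt (4 * pi * t) ^ DIM('a))"
    using assms by (simp add: ennreal_power)
  also have "sqrt (4 * pi * t) ^ DIM('a) = (4 * pi * t) powr (real DIM('a) / 2)"
    using assms by (simp add: powr_half_sqrt[symmetric] powr_realpow[symmetric] powr_powr)
  finally show ?thesis .
qed

text \<open>A boundary point is equidistant from \<open>y\<close> and its reflection, so the two
  exponentials coincide.\<close>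

lemma neumann_kernel_boundary:
  fixes x' :: "real ^ 'm::finite"
  shows "neumann_kernel (x', 0) y t =
    2 * (4 * pi * t) powr (- (real (CARD('m) + 1) / 2)) * exp (- ((norm ((x', 0) - y))\<^sup>2 / (4 * t)))"
proof -
  have "norm ((x', 0) - reflect y) = norm ((x', 0) - y)"
    by (cases y) (simp add: reflect_def norm_Pair)
  then show ?thesis by (simp add: neumann_kernel_def)
qed

context
  fixes t :: real
  assumes t: "0 < t"
begin

lemma neumann_kernel_boundary_le:
  fixes x' :: "real ^ 'm::finite"
  shows "neumann_kernel (x', 0) y t \<le> 2 * (4 * pi * t) powr (- (real (CARD('m) + 1) / 2))"
  unfolding neumann_kernel_boundary using t by (intro mult_left_le) auto

text \<open>Enlarging the half space to the whole space leaves twice a normalized Gaussian.\<close>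

lemma nn_integral_neumann_kernel_le:
  fixes x' :: "real ^ 'm::finite"
  shows "(\<integral>\<^sup>+ y. ennreal (neumann_kernel (x', 0) y t) \<partial>(lebesgue_on half_space)) \<le> ennreal 2"
proof -
  have "open (half_space :: ((real ^ 'm) \<times> real) set)"
    unfolding half_space_def by (intro open_Collect_less continuous_intros)
  then have "(\<integral>\<^sup>+ y. ennreal (neumann_kernel (x', 0) y t) \<partial>(lebesgue_on half_space)) =
      (\<integral>\<^sup>+ y. ennreal (neumann_kernel (x', 0) y t) * indicator half_space y \<partial>lebesgue)"
    by (subst nn_integral_restrict_space) auto
  also have "\<dots> \<le> (\<integral>\<^sup>+ y. ennreal (neumann_kernel (x', 0) y t) \<partial>lebesgue)"
    by (intro nn_integral_mono) (auto split: split_indicator)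
  also have "\<dots> = ennreal (2 * (4 * pi * t) powr (- (real (CARD('m) + 1) / 2))) *
      (\<integral>\<^sup>+ y. ennreal (exp (- ((norm ((x', 0 :: real) - y))\<^sup>2 / (4 * t)))) \<partial>lborel)"
    by (simp add: neumann_kernel_boundary ennreal_mult nn_integral_completion nn_integral_cmult)
  also have "\<dots> = ennreal 2"
    unfolding nn_integral_gaussian[OF t] using t
    by (simp add: powr_add[symmetric] mult.assoc flip: ennreal_mult)
  finally show ?thesis .
qed

text \<open>Dropping the height of \<open>y\<close> from the distance leaves a Gaussian in one
  dimension less, so one factor \<open>(4 * pi * t) powr (- (1 / 2))\<close> is not
  compensated.\<close>

lemma nn_integral_neumann_kernel_boundary_le:
  fixes y :: "(real ^ 'm::finite) \<times> real"
  shows "(\<integral>\<^sup>+ x'. ennreal (neumann_kernel (x', 0) y t) \<partial>lebesgue) \<le> ennreal (2 * (4 * pi * t) powr (- (1 / 2)))"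
proof -
  have "(\<integral>\<^sup>+ x'. ennreal (neumann_kernel (x', 0) y t) \<partial>lebesgue) \<le>
      (\<integral>\<^sup>+ x'. ennreal (2 * (4 * pi * t) powr (- (real (CARD('m) + 1) / 2))) *
        ennreal (exp (- ((norm (fst y - x'))\<^sup>2 / (4 * t)))) \<partial>lebesgue)"
  proof (intro nn_integral_mono)
    fix x' :: "real ^ 'm"
    have "(norm (fst y - x'))\<^sup>2 \<le> (norm ((x', 0) - y))\<^sup>2"
      by (cases y) (simp add: norm_Pair norm_minus_commute)
    then have "exp (- ((norm ((x', 0) - y))\<^sup>2 / (4 * t))) \<le> exp (- ((norm (fst y - x'))\<^sup>2 / (4 * t)))"
      using t by (simp add: divide_right_mono)
    then show "ennreal (neumann_kernel (x', 0) y t) \<le>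
      ennreal (2 * (4 * pi * t) powr (- (real (CARD('m) + 1) / 2))) * ennreal (exp (- ((norm (fst y - x'))\<^sup>2 / (4 * t))))"
      unfolding neumann_kernel_boundary by (simp add: ennreal_mult[symmetric] ennreal_leI mult_left_mono)
  qed
  also have "\<dots> = ennreal (2 * (4 * pi * t) powr (- (real (CARD('m) + 1) / 2))) *
      ennreal ((4 * pi * t) powr (real CARD('m) / 2))"
    using nn_integral_gaussian[OF t, of "fst y"] by (simp add: nn_integral_completion nn_integral_cmult)
  also have "\<dots> = ennreal (2 * (4 * pi * t) powr (- (1 / 2)))"
    by (simp add: powr_add[symmetric] add_divide_distrib flip: ennreal_mult)
  finally show ?thesis .
qed

lemma measurable_neumann_kernel_boundary [measurable]:
  "(\<lambda>(x', y). neumann_kernel (x', 0) y t) \<in>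
    borel_measurable ((lebesgue :: (real ^ 'm::finite) measure) \<Otimes>\<^sub>M lebesgue_on half_space)"
proof -
  \<comment> \<open>Regarding the identity as a map from the completed to the Borel sigma-algebra
    reduces the claim to Borel measurability of an explicit formula.\<close>
  have [measurable]: "(\<lambda>x. x) \<in> (lebesgue :: (real ^ 'm) measure) \<rightarrow>\<^sub>M borel"
    "(\<lambda>x. x) \<in> lebesgue_on (half_space :: ((real ^ 'm) \<times> real) set) \<rightarrow>\<^sub>M borel"
    by (auto intro!: measurable_restrict_space1 measurable_completion)
  show ?thesis
    unfolding neumann_kernel_boundary by measurable
qed

end

section \<open>The estimate for the boundary trace\<close>

theorem lemma4p1:
  fixes n :: nat and d1 d2 :: real and r :: ennreal
  assumes "n = CARD('m::finite) + 1" and "n \<ge> 3"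
    and "1 < d1" and "d1 < d2" and "1 \<le> r"
  shows "\<exists>C::real. C > 0 \<and>
    (\<forall>f \<in> lorentz_space d1 r (lebesgue_on (half_space :: ((real ^ 'm) \<times> real) set)). \<forall>t>0.
       (\<forall>x' :: real ^ 'm.
          integrable (lebesgue_on half_space) (\<lambda>y. neumann_kernel (x', 0) y t * f y)) \<and>
       boundary_trace (heat_op t f) \<in> lorentz_space d2 r lebesgue \<and>
       lorentz_norm d2 r lebesgue (boundary_trace (heat_op t f))
         \<le> ennreal (C * t powr (- (real n / (2 * d1) - (real n - 1) / (2 * d2)))) *
           lorentz_norm d1 r (lebesgue_on half_space) f)"
proof -
  define N :: "((real ^ 'm) \<times> real) measure" where "N = lebesgue_on half_space"
  define M :: "(real ^ 'm) measure" where "M = lebesgue"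
  have M: "sigma_finite_measure M"
    unfolding M_def by (intro sigma_finite_completion sigma_finite_lborel)
  have "half_space \<in> sets (lebesgue :: ((real ^ 'm) \<times> real) measure)"
    unfolding half_space_def
    by (intro sets_completionI_sets) (simp add: open_Collect_less continuous_intros)
  then have N: "sigma_finite_measure N"
    unfolding N_def
    by (intro sigma_finite_measure_restrict_space sigma_finite_completion sigma_finite_lborel)
  interpret N: sigma_finite_measure N by fact
  define ex where "ex = - (real n / (2 * d1) - (real n - 1) / (2 * d2))"
  \<comment> \<open>The 2 bounds the integral of the kernel over the half space,
    \<open>1 + d2 / d1\<close> comes from comparing the Lorentz norms, and the last factor from
    \<open>(4 * pi * t) powr ex\<close>.\<close>
  define C where "C = 2 * (1 + d2 / d1) * (4 * pi) powr ex"
  have "0 < C"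
    using assms by (auto simp: C_def intro!: mult_pos_pos add_pos_pos)
  moreover
  { fix f and t :: real
    assume f: "f \<in> lorentz_space d1 r N" and t: "0 < t"
    have [measurable]: "f \<in> borel_measurable N" and norm_fin: "lorentz_norm d1 r N f < \<infinity>"
      using f by (auto simp: lorentz_space_def)
    have fin: "avg_rearr N f u < \<infinity>" if "0 < u" for u
      using avg_rearr_finite_of_lorentz_norm_finite[OF _ \<open>1 \<le> r\<close> norm_fin that] assms by simp
    define K where "K x' y = neumann_kernel (x', 0) y t" for x' :: "real ^ 'm" and y
    have K [measurable]: "case_prod K \<in> borel_measurable (M \<Otimes>\<^sub>M N)"
      using measurable_neumann_kernel_boundary[OF t, where 'm = 'm] by (simp add: K_def[abs_def] M_def N_def)
    have Kx [measurable]: "K x' \<in> borel_measurable N" for x'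
      using measurable_compose[OF measurable_Pair1' K] by (simp add: M_def)
    define L where "L = 4 * pi * t"
    have "0 < L" using t by (simp add: L_def)
    define A where "A = 2 * L powr (- (real n / 2))"
    define B where "B = 2 * L powr (- (1 / 2))"
    define a where "a = L powr (real n / 2)"
    define b where "b = L powr (1 / 2)"
    have pos: "0 < A" "0 < B" "0 < a" "0 < b" and a: "2 / A = a" and b: "2 / B = b"
      using \<open>0 < L\<close> by (auto simp: A_def B_def a_def b_def powr_minus field_simps)
    have K_nonneg: "0 \<le> K x' y" and K_le: "K x' y \<le> A" for x' y
      using neumann_kernel_boundary_le[OF t, of x' y]
      by (auto simp: K_def A_def L_def assms(1) neumann_kernel_boundary)
    have int_N: "(\<integral>\<^sup>+ y. ennreal (K x' y) \<partial>N) \<le> ennreal 2" for x'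
      using nn_integral_neumann_kernel_le[OF t] by (simp only: K_def N_def)
    have int_M: "(\<integral>\<^sup>+ x'. ennreal (K x' y) \<partial>M) \<le> ennreal B" for y
      using nn_integral_neumann_kernel_boundary_le[OF t] by (simp only: K_def M_def B_def L_def)
    have abs_le: "(\<integral>\<^sup>+ y. ennreal (K x' y * \<bar>f y\<bar>) \<partial>N) \<le> ennreal 2 * avg_rearr N f a" for x'
      using nn_integral_mult_le_avg_rearr[OF N, of f "K x'" A 2] K_nonneg K_le int_N fin pos
      by (simp add: a)
    have norm_eq: "norm (K x' y * f y) = K x' y * \<bar>f y\<bar>" for x' y
      by (simp add: abs_mult K_nonneg)
    \<comment> \<open>Makes the trace a genuine integral: the Bochner integral of a non-integrable
      function would default to 0.\<close>
    have int: "integrable N (\<lambda>y. K x' y * f y)" for x'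
      unfolding integrable_iff_bounded norm_eq
      using le_less_trans[OF abs_le[of x']] fin[OF \<open>0 < a\<close>] by (auto simp: ennreal_mult_less_top)
    define g where "g = boundary_trace (heat_op t f)"
    have g: "g = (\<lambda>x'. \<integral>y. K x' y * f y \<partial>N)"
      by (simp add: g_def boundary_trace_def heat_op_def K_def N_def fun_eq_iff)
    have g_meas [measurable]: "g \<in> borel_measurable M"
      unfolding g by measurable
    have g_le: "ennreal \<bar>g x'\<bar> \<le> (\<integral>\<^sup>+ y. ennreal (K x' y * \<bar>f y\<bar>) \<partial>N)" for x'
      using integral_norm_bound_ennreal[OF int[of x']] unfolding norm_eq by (simp add: g)
    \<comment> \<open>For \<open>b * s \<le> a\<close> the uniform bound on the trace is used,
      beyond that the operator bound, whose argument \<open>2 / B * s\<close> is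
      \<open>b * s\<close>.\<close>
    have "avg_rearr M g s \<le> ennreal 2 * avg_rearr N f (max a (b * s))" if "0 < s" for s
    proof (cases "b * s \<le> a")
      case True
      then show ?thesis
        using avg_rearr_le_of_abs_le[OF \<open>0 < s\<close>, of M g] order_trans[OF g_le abs_le] by (simp add: max_def)
    next
      case False
      then show ?thesis
        using avg_rearr_kernel_le[OF M N K _ g_meas K_nonneg int_N int_M \<open>0 < B\<close> _ \<open>0 < s\<close> _ g_le]
          fin[of "b * s"] pos that by (simp add: b max_def)
    qed
    then have "lorentz_norm d2 r M g \<le>
        ennreal (2 * (1 + d2 / d1) * (b powr (- (1 / d2)) * a powr (1 / d2 - 1 / d1))) * lorentz_norm d1 r N f"
      using assms pos by (intro lorentz_norm_le_of_avg_rearr_le) auto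
    also have "b powr (- (1 / d2)) * a powr (1 / d2 - 1 / d1) = L powr ex"
    proof -
      \<comment> \<open>\<open>b\<close> and \<open>a\<close> are the powers \<open>1 / 2\<close>
        and \<open>n / 2\<close> of \<open>L\<close>; adding the exponents produces the stated decay
        rate.\<close>
      have "1 / 2 * - (1 / d2) + real n / 2 * (1 / d2 - 1 / d1) = ex"
        using assms(3,4) by (simp add: ex_def field_simps)
      then show ?thesis
        by (simp only: a_def b_def powr_powr powr_add[symmetric])
    qed
    also have "2 * (1 + d2 / d1) * L powr ex = C * t powr ex"
      using t by (simp add: C_def L_def powr_mult)
    finally have le: "lorentz_norm d2 r M g \<le> ennreal (C * t powr ex) * lorentz_norm d1 r N f" .
    also have "\<dots> < \<infinity>"
      using norm_fin by (auto simp: ennreal_mult_less_top)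
    finally have "g \<in> lorentz_space d2 r M"
      by (simp add: lorentz_space_def)
    with int le have "(\<forall>x'. integrable N (\<lambda>y. neumann_kernel (x', 0) y t * f y)) \<and>
        boundary_trace (heat_op t f) \<in> lorentz_space d2 r M \<and>
        lorentz_norm d2 r M (boundary_trace (heat_op t f)) \<le> ennreal (C * t powr ex) * lorentz_norm d1 r N f"
      by (simp add: K_def g_def) }
  ultimately show ?thesis
    unfolding M_def N_def ex_def by blast
qed

end
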